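(* Consider the second order finite difference scheme in one dimension: for $i=1,\dots,N$, $$\mathcal M_i g_i^{n+1}+\Delta t\,\frac{u_{i-1}g_{i-1}^{n+1}-u_{i+1}g_{i+1}^{n+1}}{2h}+\Delta t\,\frac{-D(\mathcal M_{i-1}+\mathcal M_i)g_{i-1}^{n+1}+D(\mathcal M_{i-1}+2\mathcal M_i+\mathcal M_{i+1})g_i^{n+1}-D(\mathcal M_i+\mathcal M_{i+1})g_{i+1}^{n+1}}{2h^2}=\mathcal M_i g_i^n .$$ Suppose that $$h|u_j|\le D\min\{\mathcal M_{j-1},\mathcal M_j,\mathcal M_{j+1}\}\quad\forall j=1,\dots,N,$$ and $$\mathcal M_i+\Delta t\,\frac{u_{i-1}-u_{i+1}}{2h}>0\quad\forall i=1,\dots,N.$$ Then the coefficient matrix for the unknown vector $g^{n+1}=(g_1^{n+1},\dots,g_N^{n+1})$ is an M-matrix and thus is monotone. In particular, in one dimension, where a discrete divergence free velocity field $u$ is constant, for such $u$ the scheme is monotone under the first constraint alone.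
   Context: $\Omega=[-L,L]$ with uniform grid points $-L=x_1<\dots<x_N=L$ of spacing $h$ ($N\ge3$); $D>0$ is a constant, $\Delta t>0$. $\mathcal M_i=\mathcal M(x_i)>0$ are point values of a given positive function $\mathcal M$, and $u_i=u(x_i)$ are point values of a given velocity with $u_1=u_N=0$ (boundary condition $\vec u\cdot\vec n=0$). Ghost values: $g_0:=g_2$, $g_{N+1}:=g_{N-1}$, $\mathcal M_0:=\mathcal M_2$, $\mathcal M_{N+1}:=\mathcal M_{N-1}$, $u_0:=-u_2$, $u_{N+1}:=-u_{N-1}$; these are substituted so that the scheme is an $N\times N$ linear system. A square matrix $A$ is monotone if it is invertible and all entries of $A^{-1}$ are nonnegative. A square matrix $A$ is an M-matrix if $A=sI-B$ with $B\ge0$ entrywise and $s$ greater than the spectral radius of $B$. A scheme is called monotone if its coefficient matrix is monotone. *)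

theory Defs
  imports "Jordan_Normal_Form.Spectral_Radius"
begin

definition nonneg_mat :: "real mat \<Rightarrow> bool" where
  "nonneg_mat A \<longleftrightarrow> (\<forall>a \<in> elements_mat A. 0 \<le> a)"

definition monotone_mat :: "real mat \<Rightarrow> bool" where
  "monotone_mat A \<longleftrightarrow> invertible_mat A \<and>
     (\<forall>B. inverts_mat A B \<and> inverts_mat B A \<longrightarrow> nonneg_mat B)"

(* The spectral radius is taken over the complex eigenvalues of the real matrix B. *)
definition M_matrix :: "real mat \<Rightarrow> bool" where
  "M_matrix A \<longleftrightarrow> square_mat A \<and>
     (\<exists>s B. B \<in> carrier_mat (dim_row A) (dim_row A) \<and> nonneg_mat B \<and>
        A = s \<cdot>\<^sub>m 1\<^sub>m (dim_row A) - B \<and> s > spectral_radius (map_mat complex_of_real B))"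

text \<open>Grid functions are sequences indexed by \<open>1..N\<close>; the indices \<open>0\<close> and \<open>N+1\<close>
  carry the ghost values. Vectors and matrices are indexed from \<open>0\<close>, so that
  component \<open>k\<close> of a vector belongs to the grid point with index \<open>k + 1\<close>.\<close>

definition uniform_grid :: "real \<Rightarrow> nat \<Rightarrow> real \<Rightarrow> (nat \<Rightarrow> real) \<Rightarrow> bool" where
  "uniform_grid L N h x \<longleftrightarrow>
     h > 0 \<and> x 1 = - L \<and> x N = L \<and> (\<forall>i\<in>{1..<N}. x (i + 1) - x i = h)"

definition even_ghost :: "nat \<Rightarrow> (nat \<Rightarrow> real) \<Rightarrow> nat \<Rightarrow> real" where
  "even_ghost N v i = (if i = 0 then v 2 else if i = N + 1 then v (N - 1) else v i)"

definition odd_ghost :: "nat \<Rightarrow> (nat \<Rightarrow> real) \<Rightarrow> nat \<Rightarrow> real" where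
  "odd_ghost N v i = (if i = 0 then - v 2 else if i = N + 1 then - v (N - 1) else v i)"

(* M, u and g already include their ghost values; i ranges over 1..N. *)
definition scheme_lhs ::
  "real \<Rightarrow> real \<Rightarrow> real \<Rightarrow> (nat \<Rightarrow> real) \<Rightarrow> (nat \<Rightarrow> real) \<Rightarrow> (nat \<Rightarrow> real) \<Rightarrow> nat \<Rightarrow> real" where
  "scheme_lhs h D dt M u g i =
     M i * g i
     + dt * ((u (i - 1) * g (i - 1) - u (i + 1) * g (i + 1)) / (2 * h))
     + dt * ((- D * (M (i - 1) + M i) * g (i - 1)
              + D * (M (i - 1) + 2 * M i + M (i + 1)) * g i
              - D * (M i + M (i + 1)) * g (i + 1)) / (2 * h\<^sup>2))"

definition scheme ::
  "nat \<Rightarrow> real \<Rightarrow> real \<Rightarrow> real \<Rightarrow> (nat \<Rightarrow> real) \<Rightarrow> (nat \<Rightarrow> real) \<Rightarrow> (nat \<Rightarrow> real) \<Rightarrow> (nat \<Rightarrow> real) \<Rightarrow> bool"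
where
  "scheme N h D dt M u gold gnew \<longleftrightarrow>
     (\<forall>i\<in>{1..N}. scheme_lhs h D dt M u (even_ghost N gnew) i = M i * gold i)"

(* The left-hand side of the scheme, after substitution of the ghost values, as a map on R^N. *)
definition scheme_map ::
  "nat \<Rightarrow> real \<Rightarrow> real \<Rightarrow> real \<Rightarrow> (nat \<Rightarrow> real) \<Rightarrow> (nat \<Rightarrow> real) \<Rightarrow> real vec \<Rightarrow> real vec" where
  "scheme_map N h D dt M u g =
     vec N (\<lambda>k. scheme_lhs h D dt M u (even_ghost N (\<lambda>i. g $ (i - 1))) (k + 1))"

(* The matrix of the linear map scheme_map; see scheme_iff_linear_system. *)
definition coeff_matrix ::
  "nat \<Rightarrow> real \<Rightarrow> real \<Rightarrow> real \<Rightarrow> (nat \<Rightarrow> real) \<Rightarrow> (nat \<Rightarrow> real) \<Rightarrow> real mat" where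
  "coeff_matrix N h D dt M u = mat N N (\<lambda>(k, j). scheme_map N h D dt M u (unit_vec N j) $ k)"

definition discrete_div :: "real \<Rightarrow> (nat \<Rightarrow> real) \<Rightarrow> nat \<Rightarrow> real" where
  "discrete_div h u i = (u (i + 1) - u (i - 1)) / (2 * h)"

lemma even_ghost_expand:
  assumes "N \<ge> 3" "i \<le> N + 1"
  shows "even_ghost N (\<lambda>i. g $ (i - 1)) i
       = (\<Sum>j<N. even_ghost N (\<lambda>i. unit_vec N j $ (i - 1)) i * g $ j)"
proof -
  define m where "m = (if i = 0 then 1 else if i = N + 1 then N - 2 else i - 1)"
  have m: "m < N" using assms by (auto simp: m_def)
  have e: "even_ghost N (\<lambda>i. v $ (i - 1)) i = v $ m" for v :: "real vec"
    using assms by (auto simp: even_ghost_def m_def numeral_eq_Suc)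
  have "(\<Sum>j<N. unit_vec N j $ m * g $ j) = (\<Sum>j<N. if j = m then g $ j else 0)"
    using m by (intro sum.cong) auto
  also have "\<dots> = g $ m" using m by simp
  finally show ?thesis unfolding e by simp
qed

lemma scheme_lhs_sum:
  assumes "N \<ge> 3" "i \<in> {1..N}"
  shows "scheme_lhs h D dt M u (even_ghost N (\<lambda>i. g $ (i - 1))) i
       = (\<Sum>j<N. scheme_lhs h D dt M u (even_ghost N (\<lambda>i. unit_vec N j $ (i - 1))) i * g $ j)"
proof -
  let ?e = "\<lambda>j. even_ghost N (\<lambda>i. unit_vec N j $ (i - 1)) :: nat \<Rightarrow> real"
  define a where "a = dt * (u (i - 1) / (2 * h) - D * (M (i - 1) + M i) / (2 * h\<^sup>2))"
  define b where "b = M i + dt * (D * (M (i - 1) + 2 * M i + M (i + 1)) / (2 * h\<^sup>2))"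
  define c where "c = dt * (- u (i + 1) / (2 * h) - D * (M i + M (i + 1)) / (2 * h\<^sup>2))"
  have lin: "scheme_lhs h D dt M u f i = a * f (i - 1) + b * f i + c * f (i + 1)" for f
    unfolding scheme_lhs_def a_def b_def c_def
    by (simp add: algebra_simps add_divide_distrib diff_divide_distrib)
  have i: "i - 1 \<le> N + 1" "i \<le> N + 1" "i + 1 \<le> N + 1" using assms by auto
  show ?thesis
    unfolding lin even_ghost_expand[OF assms(1) i(1), of g]
      even_ghost_expand[OF assms(1) i(2), of g] even_ghost_expand[OF assms(1) i(3), of g]
      sum_distrib_left sum.distrib[symmetric]
    by (intro sum.cong) (auto simp: algebra_simps)
qed

lemma scheme_iff_linear_system:
  assumes "N \<ge> 3"
  shows "scheme N h D dt M u gold gnew \<longleftrightarrow>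
    coeff_matrix N h D dt M u *\<^sub>v vec N (\<lambda>k. gnew (k + 1)) = vec N (\<lambda>k. M (k + 1) * gold (k + 1))"
proof -
  let ?g = "vec N (\<lambda>k. gnew (k + 1))"
  have g: "even_ghost N (\<lambda>i. ?g $ (i - 1)) i = even_ghost N gnew i" if "i \<le> N + 1" for i
    using that assms by (auto simp: even_ghost_def numeral_eq_Suc Suc_diff_Suc)
  have "(coeff_matrix N h D dt M u *\<^sub>v ?g) $ k = scheme_lhs h D dt M u (even_ghost N gnew) (k + 1)"
    if k: "k < N" for k
  proof -
    have "(coeff_matrix N h D dt M u *\<^sub>v ?g) $ k
        = (\<Sum>j<N. scheme_lhs h D dt M u (even_ghost N (\<lambda>i. unit_vec N j $ (i - 1))) (k + 1) * ?g $ j)"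
      using k by (simp add: coeff_matrix_def scheme_map_def scalar_prod_def atLeast0LessThan)
    also have "\<dots> = scheme_lhs h D dt M u (even_ghost N (\<lambda>i. ?g $ (i - 1))) (k + 1)"
      by (rule scheme_lhs_sum[symmetric]) (use assms k in auto)
    also have "\<dots> = scheme_lhs h D dt M u (even_ghost N gnew) (k + 1)"
      using k g[of k] g[of "k + 1"] g[of "k + 2"] by (simp add: scheme_lhs_def)
    finally show ?thesis .
  qed
  moreover have "(\<forall>i\<in>{1..N}. P i) \<longleftrightarrow> (\<forall>k<N. P (k + 1))" for P :: "nat \<Rightarrow> bool"
    by (metis Suc_eq_plus1 Suc_le_eq Suc_pred atLeastAtMost_iff le_add2 less_eq_Suc_le One_nat_def)
  moreover have "dim_vec (coeff_matrix N h D dt M u *\<^sub>v ?g) = N" by (simp add: coeff_matrix_def)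
  ultimately show ?thesis unfolding scheme_def vec_eq_iff by auto
qed

end

theory Submission
  imports Defs
begin

text \<open>The second constraint says that the coefficient matrix has positive row sums, and the first
  one makes its off-diagonal entries nonpositive. Such a matrix satisfies a discrete minimum
  principle (look at a row where the solution is minimal), which gives monotonicity. Writing
  \<open>A = s I - B\<close> with \<open>s\<close> above the diagonal, \<open>B\<close> is nonnegative with row sums below \<open>s\<close>, so
  the modulus of every eigenvalue is below \<open>s\<close> (look at the largest component of an
  eigenvector).\<close>

section \<open>Matrices with nonpositive off-diagonal entries and positive row sums\<close>

lemma nonneg_mat_iff:
  "nonneg_mat A \<longleftrightarrow> (\<forall>i<dim_row A. \<forall>j<dim_col A. 0 \<le> A $$ (i, j))"
  unfolding nonneg_mat_def elements_mat_def by fastforce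

lemma mult_mat_vec_index_sum:
  assumes "A \<in> carrier_mat n m" "v \<in> carrier_vec m" "i < n"
  shows "(A *\<^sub>v v) $ i = (\<Sum>j<m. A $$ (i, j) * v $ j)"
  using assms by (auto simp: scalar_prod_def atLeast0LessThan intro!: sum.cong)

lemma minimum_principle:
  fixes A :: "real mat"
  assumes A: "A \<in> carrier_mat n n"
    and off: "\<And>i j. i < n \<Longrightarrow> j < n \<Longrightarrow> i \<noteq> j \<Longrightarrow> A $$ (i, j) \<le> 0"
    and row: "\<And>i. i < n \<Longrightarrow> 0 < (\<Sum>j<n. A $$ (i, j))"
    and v: "v \<in> carrier_vec n"
    and Av: "\<And>i. i < n \<Longrightarrow> 0 \<le> (A *\<^sub>v v) $ i"
    and i: "i < n"
  shows "0 \<le> v $ i"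
proof -
  obtain k where k: "k < n" and min: "\<And>j. j < n \<Longrightarrow> v $ k \<le> v $ j"
    using ex_is_arg_min_if_finite[of "{..<n}" "\<lambda>j. v $ j"] i
    by (fastforce simp: is_arg_min_linorder)
  \<comment> \<open>For \<open>j \<noteq> k\<close> the nonpositive entry reverses
    \<open>v $ k \<le> v $ j\<close>; for \<open>j = k\<close> both sides agree.\<close>
  have "A $$ (k, j) * v $ j \<le> A $$ (k, j) * v $ k" if "j < n" for j
    using off[of k j] min[of j] that k by (cases "j = k") (auto intro: mult_left_mono_neg)
  then have "(A *\<^sub>v v) $ k \<le> (\<Sum>j<n. A $$ (k, j)) * v $ k"
    unfolding mult_mat_vec_index_sum[OF A v k] sum_distrib_right by (auto intro: sum_mono)
  then have "0 \<le> (\<Sum>j<n. A $$ (k, j)) * v $ k"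
    using Av[OF k] by linarith
  then have "0 \<le> v $ k"
    using row[OF k] by (simp add: zero_le_mult_iff)
  then show ?thesis using min[OF i] by linarith
qed

lemma monotone_mat_if_row_sums_pos:
  fixes A :: "real mat"
  assumes A: "A \<in> carrier_mat n n"
    and off: "\<And>i j. i < n \<Longrightarrow> j < n \<Longrightarrow> i \<noteq> j \<Longrightarrow> A $$ (i, j) \<le> 0"
    and row: "\<And>i. i < n \<Longrightarrow> 0 < (\<Sum>j<n. A $$ (i, j))"
  shows "monotone_mat A"
proof -
  note mp = minimum_principle[OF A off row]
  \<comment> \<open>Injectivity: the minimum principle applies to both \<open>v\<close> and its
    negative, so every component is zero.\<close>
  have "v = 0\<^sub>v n" if v: "v \<in> carrier_vec n" and Av: "A *\<^sub>v v = 0\<^sub>v n" for v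
  proof -
    have "A *\<^sub>v ((- 1) \<cdot>\<^sub>v v) = 0\<^sub>v n"
      unfolding mult_mat_vec[OF A v] Av by (intro eq_vecI) auto
    then have "0 \<le> v $ i" "0 \<le> ((- 1) \<cdot>\<^sub>v v) $ i" if "i < n" for i
      using mp[of v i] mp[of "(- 1) \<cdot>\<^sub>v v" i] v Av that by auto
    then show ?thesis using v by (intro eq_vecI) force+
  qed
  then have "det A \<noteq> 0"
    using det_0_iff_vec_prod_zero_field[OF A] by blast
  then have "A \<in> Units (ring_mat TYPE(real) n ())"
    by (rule det_non_zero_imp_unit[OF A])
  then have "invertible_mat A"
    unfolding Units_def ring_mat_simps invertible_mat_def inverts_mat_def by auto
  moreover have "nonneg_mat B" if AB: "A * B = 1\<^sub>m n" and BA: "B * A = 1\<^sub>m (dim_row B)" for B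
  proof -
    \<comment> \<open>\<open>monotone_mat\<close> quantifies over inverses of arbitrary dimensions;
      the two product equations determine them.\<close>
    have B: "B \<in> carrier_mat n n"
      using A AB BA by (metis carrier_matD(2) carrier_matI index_mult_mat(3) index_one_mat(3))
    have "0 \<le> B $$ (i, j)" if "i < n" "j < n" for i j
    proof -
      \<comment> \<open>Column \<open>j\<close> of the inverse solves a system with nonnegative
        right-hand side, so the minimum principle applies to it.\<close>
      have "A *\<^sub>v col B j = unit_vec n j"
        using A B AB that by (metis col_mult2 col_one)
      then show ?thesis
        using mp[of "col B j" i] that B by auto
    qed
    then show ?thesis
      using B by (auto simp: nonneg_mat_iff)
  qed
  ultimately show ?thesis
    using A unfolding monotone_mat_def inverts_mat_def by auto
qed

text \<open>Comparing both sides of the eigenvalue equation at a component of largest modulus bounds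
  the eigenvalue by the absolute sum of that row, as in Gershgorin's theorem. With
  \<open>0 < n\<close> the spectrum is nonempty, so the spectral radius is attained.\<close>

lemma spectral_radius_less_if_row_sums_less:
  fixes B :: "complex mat"
  assumes B: "B \<in> carrier_mat n n" and n: "0 < n"
    and row: "\<And>i. i < n \<Longrightarrow> (\<Sum>j<n. cmod (B $$ (i, j))) < s"
  shows "spectral_radius B < s"
proof -
  from spectral_radius_mem_max(1)[OF B n] obtain l where
    l: "spectral_radius B = cmod l" and "eigenvalue B l"
    by (auto simp: spectrum_def)
  then obtain v where v: "v \<in> carrier_vec n" "v \<noteq> 0\<^sub>v n" and ev: "B *\<^sub>v v = l \<cdot>\<^sub>v v"
    using B unfolding eigenvalue_def eigenvector_def by auto
  obtain k where k: "k < n" and max: "\<And>j. j < n \<Longrightarrow> cmod (v $ j) \<le> cmod (v $ k)"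
    using ex_is_arg_min_if_finite[of "{..<n}" "\<lambda>j. - cmod (v $ j)"] n
    by (fastforce simp: is_arg_min_linorder)
  have pos: "0 < cmod (v $ k)"
  proof (rule ccontr)
    assume "\<not> 0 < cmod (v $ k)"
    then have "v = 0\<^sub>v n" using max v by (intro eq_vecI) force+
    with v show False by simp
  qed
  have "cmod l * cmod (v $ k) = cmod (\<Sum>j<n. B $$ (k, j) * v $ j)"
    using mult_mat_vec_index_sum[OF B v(1) k] ev v k by (simp flip: norm_mult)
  also have "\<dots> \<le> (\<Sum>j<n. cmod (B $$ (k, j)) * cmod (v $ k))"
    using max by (intro order.trans[OF norm_sum] sum_mono) (auto simp: norm_mult intro: mult_left_mono)
  also have "\<dots> < s * cmod (v $ k)"
    unfolding sum_distrib_right[symmetric] using row[OF k] pos by simp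
  finally show ?thesis using l pos by simp
qed

lemma M_matrix_if_row_sums_pos:
  fixes A :: "real mat"
  assumes A: "A \<in> carrier_mat n n" and n: "0 < n"
    and off: "\<And>i j. i < n \<Longrightarrow> j < n \<Longrightarrow> i \<noteq> j \<Longrightarrow> A $$ (i, j) \<le> 0"
    and row: "\<And>i. i < n \<Longrightarrow> 0 < (\<Sum>j<n. A $$ (i, j))"
  shows "M_matrix A"
proof -
  \<comment> \<open>A simple upper bound for all diagonal entries, which makes the diagonal of
    \<open>B\<close> nonnegative.\<close>
  define s where "s = (\<Sum>i<n. \<bar>A $$ (i, i)\<bar>)"
  define B where "B = s \<cdot>\<^sub>m 1\<^sub>m n - A"
  have B: "B \<in> carrier_mat n n" using A by (simp add: B_def minus_carrier_mat)
  have s: "A $$ (i, i) \<le> s" if "i < n" for i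
    using member_le_sum[of i "{..<n}" "\<lambda>i. \<bar>A $$ (i, i)\<bar>"] that by (simp add: s_def)
  have entry: "B $$ (i, j) = (if i = j then s else 0) - A $$ (i, j)" if "i < n" "j < n" for i j
    using A that by (simp add: B_def)
  have nonneg: "0 \<le> B $$ (i, j)" if "i < n" "j < n" for i j
    using s off[of i j] that by (auto simp: entry)
  have "spectral_radius (map_mat complex_of_real B) < s"
  proof (rule spectral_radius_less_if_row_sums_less[OF _ n])
    fix i assume i: "i < n"
    have "(\<Sum>j<n. cmod (map_mat complex_of_real B $$ (i, j))) = (\<Sum>j<n. B $$ (i, j))"
      using B i nonneg by (intro sum.cong) auto
    \<comment> \<open>Positive row sums of \<open>A\<close> become row sums of \<open>B\<close>
      below \<open>s\<close>.\<close>
    also have "\<dots> = s - (\<Sum>j<n. A $$ (i, j))"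
      using i by (simp add: entry sum_subtractf)
    finally show "(\<Sum>j<n. cmod (map_mat complex_of_real B $$ (i, j))) < s"
      using row[OF i] by simp
  qed (use B in simp)
  moreover have "A = s \<cdot>\<^sub>m 1\<^sub>m n - B"
    using A by (intro eq_matI) (auto simp: B_def)
  moreover have "nonneg_mat B"
    using B nonneg by (auto simp: nonneg_mat_iff)
  ultimately show ?thesis
    using A B unfolding M_matrix_def by auto
qed

section \<open>The coefficient matrix of the scheme, its grid and its velocity\<close>

lemma coeff_matrix_carrier: "coeff_matrix N h D dt M u \<in> carrier_mat N N"
  by (simp add: coeff_matrix_def)

lemma coeff_matrix_index:
  assumes "k < N" "j < N"
  shows "coeff_matrix N h D dt M u $$ (k, j)
    = scheme_lhs h D dt M u (even_ghost N (\<lambda>i. unit_vec N j $ (i - 1))) (k + 1)"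
  using assms by (simp add: coeff_matrix_def scheme_map_def)

text \<open>Row sums are the image of the constant vector 1. Even reflection keeps it constant, and
  the diffusion coefficients of a row cancel, leaving the mass and advection terms.\<close>

lemma coeff_matrix_row_sum:
  assumes "N \<ge> 3" "k < N"
  shows "(\<Sum>j<N. coeff_matrix N h D dt M u $$ (k, j))
    = M (k + 1) + dt * ((u k - u (k + 2)) / (2 * h))"
proof -
  let ?one = "vec N (\<lambda>_. 1) :: real vec"
  have one: "even_ghost N (\<lambda>i. ?one $ (i - 1)) i = 1" if "i \<le> N + 1" for i
    using that assms by (auto simp: even_ghost_def)
  have "(\<Sum>j<N. coeff_matrix N h D dt M u $$ (k, j))
      = scheme_lhs h D dt M u (even_ghost N (\<lambda>i. ?one $ (i - 1))) (k + 1)"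
    using assms by (subst scheme_lhs_sum) (auto simp: coeff_matrix_index intro!: sum.cong)
  also have "\<dots> = M (k + 1) + dt * ((u k - u (k + 2)) / (2 * h))"
    using assms one[of k] one[of "k + 1"] one[of "k + 2"]
    by (simp add: scheme_lhs_def algebra_simps)
  finally show ?thesis .
qed

text \<open>\<open>left\<close> and \<open>right\<close> say that the coefficients of both
  neighbours are nonpositive. At a boundary row, reflection folds both neighbours onto one column,
  where two nonpositive coefficients add up.\<close>

lemma coeff_matrix_off_diagonal:
  assumes h: "h > 0" and dt: "dt > 0" and N: "N \<ge> 3"
    and left: "\<And>i. i \<in> {1..N} \<Longrightarrow> h * u (i - 1) \<le> D * (M (i - 1) + M i)"
    and right: "\<And>i. i \<in> {1..N} \<Longrightarrow> - (h * u (i + 1)) \<le> D * (M i + M (i + 1))"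
    and k: "k < N" and j: "j < N" and kj: "k \<noteq> j"
  shows "coeff_matrix N h D dt M u $$ (k, j) \<le> 0"
proof -
  define e where "e = even_ghost N (\<lambda>i. unit_vec N j $ (i - 1) :: real)"
  have e: "0 \<le> e i" if "i \<le> N + 1" for i
    using that N j by (auto simp: e_def even_ghost_def)
  \<comment> \<open>Row \<open>k\<close> belongs to grid index \<open>k + 1\<close>, so this removes
    the diagonal term of the stencil.\<close>
  have e0: "e (k + 1) = 0"
    using k j kj by (auto simp: e_def even_ghost_def)
  have "coeff_matrix N h D dt M u $$ (k, j) = scheme_lhs h D dt M u e (k + 1)"
    using k j by (simp add: coeff_matrix_index e_def)
  also have "\<dots> = dt / (2 * h\<^sup>2) * ((h * u k - D * (M k + M (k + 1))) * e k
      + (- (h * u (k + 2)) - D * (M (k + 1) + M (k + 2))) * e (k + 2))"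
    using h e0 by (simp add: scheme_lhs_def field_simps power2_eq_square)
  also have "\<dots> \<le> 0"
  proof (rule mult_nonneg_nonpos)
    show "(h * u k - D * (M k + M (k + 1))) * e k
      + (- (h * u (k + 2)) - D * (M (k + 1) + M (k + 2))) * e (k + 2) \<le> 0"
      using left[of "k + 1"] right[of "k + 1"] k e
      by (intro add_nonpos_nonpos mult_nonpos_nonneg) auto
  qed (use dt in simp)
  finally show ?thesis .
qed

text \<open>Positivity of \<open>Mfun\<close> is assumed on the interval only. The closed form
  \<open>x (Suc m) = - L + m * h\<close> is increasing in \<open>m\<close> and ends at
  \<open>L\<close>.\<close>

lemma uniform_grid_mem:
  assumes "uniform_grid L N h x" "i \<in> {1..N}"
  shows "x i \<in> {- L..L}"
proof -
  have h: "h > 0" and x1: "x 1 = - L" and xN: "x N = L"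
    and step: "\<And>i. i \<in> {1..<N} \<Longrightarrow> x (i + 1) - x i = h"
    using assms(1) by (auto simp: uniform_grid_def)
  have x: "x (Suc m) = - L + m * h" if "m < N" for m
    using that
  proof (induction m)
    case (Suc m)
    then show ?case using step[of "Suc m"] by (simp add: algebra_simps)
  qed (use x1 in simp)
  obtain m where m: "i = Suc m" "m < N" using assms(2) by (cases i) auto
  have "x N = - L + real (N - 1) * h"
    using x[of "N - 1"] m by simp
  moreover have "real m * h \<le> real (N - 1) * h"
    using m h by (intro mult_right_mono) auto
  ultimately show ?thesis
    using x[of m] m h xN by simp
qed

text \<open>The central difference links only indices of equal parity. Odd indices inherit
  \<open>u 1 = 0\<close>; even ones inherit \<open>u 0 = 0\<close>, since \<open>u 2 = u 0\<close>
  and \<open>u 0 = - u 2\<close>.\<close>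

lemma vanishes_if_discrete_div_zero:
  assumes h: "h > 0" and N: "0 < N" and div: "\<And>i. i \<in> {1..N} \<Longrightarrow> discrete_div h u i = 0"
    and u1: "u 1 = 0" and u0: "u 0 = - u 2" and "i \<le> N + 1"
  shows "u i = 0"
  using \<open>i \<le> N + 1\<close>
proof (induction i rule: less_induct)
  case (less i)
  have step: "u (m + 2) = u m" if "m < N" for m
    using div[of "m + 1"] h that by (simp add: discrete_div_def)
  consider "i = 0" | "i = 1" | m where "i = m + 2"
    by (metis One_nat_def add_2_eq_Suc' gr0I not0_implies_Suc)
  then show ?case
  proof cases
    case 1
    then show ?thesis using step[of 0] N u0 by (simp add: numeral_2_eq_2)
  next
    case 3
    then show ?thesis using step[of m] less by simp
  qed (use u1 in simp)
qed

theorem theorem3p3: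
  fixes L D h dt :: real and N :: nat
    and x M u :: "nat \<Rightarrow> real" and Mfun ufun :: "real \<Rightarrow> real"
  assumes "N \<ge> 3" and "D > 0" and "dt > 0"
    and "uniform_grid L N h x"
    and "\<forall>y\<in>{-L..L}. Mfun y > 0"
    and "ufun (x 1) = 0" and "ufun (x N) = 0"
    and "M = even_ghost N (\<lambda>i. Mfun (x i))"
    and "u = odd_ghost N (\<lambda>i. ufun (x i))"
  shows "((\<forall>j\<in>{1..N}. h * \<bar>u j\<bar> \<le> D * Min {M (j - 1), M j, M (j + 1)}) \<and>
          (\<forall>i\<in>{1..N}. M i + dt * ((u (i - 1) - u (i + 1)) / (2 * h)) > 0) \<longrightarrow>
            M_matrix (coeff_matrix N h D dt M u) \<and> monotone_mat (coeff_matrix N h D dt M u)) \<and>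
         ((\<forall>i\<in>{1..N}. discrete_div h u i = 0) \<longrightarrow> (\<exists>c. \<forall>i\<in>{1..N}. u i = c)) \<and>
         ((\<forall>j\<in>{1..N}. h * \<bar>u j\<bar> \<le> D * Min {M (j - 1), M j, M (j + 1)}) \<and>
          (\<exists>c. \<forall>i\<in>{1..N}. u i = c) \<longrightarrow>
            monotone_mat (coeff_matrix N h D dt M u))"
proof -
  let ?A = "coeff_matrix N h D dt M u"
  let ?c1 = "\<forall>j\<in>{1..N}. h * \<bar>u j\<bar> \<le> D * Min {M (j - 1), M j, M (j + 1)}"
  let ?c2 = "\<forall>i\<in>{1..N}. M i + dt * ((u (i - 1) - u (i + 1)) / (2 * h)) > 0"
  note N = assms(1)
  have h: "h > 0" using assms(4) by (simp add: uniform_grid_def)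
  have u: "u 1 = 0" "u 0 = - u 2" "u (N + 1) = - u (N - 1)"
    using assms(6,9) N by (auto simp: odd_ghost_def)
  have M_ghost: "M 0 = M 2" "M (N + 1) = M (N - 1)"
    using assms(8) N by (auto simp: even_ghost_def)
  have M_inner: "M i > 0" if "i \<in> {1..N}" for i
    using that assms(5,8) uniform_grid_mem[OF assms(4) that] by (auto simp: even_ghost_def)
  have M_pos: "M i > 0" if "i \<le> N + 1" for i
  proof -
    consider "i = 0" | "i = N + 1" | "i \<in> {1..N}" using \<open>i \<le> N + 1\<close> by (cases i; cases "i = N + 1") auto
    then show ?thesis using M_inner M_ghost N by cases auto
  qed
  have both: "M_matrix ?A \<and> monotone_mat ?A" if c1: ?c1 and c2: ?c2
  proof -
    have bound: "h * \<bar>u j\<bar> \<le> D * M j" if "j \<in> {1..N}" for j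
    proof -
      have "h * \<bar>u j\<bar> \<le> D * Min {M (j - 1), M j, M (j + 1)}" using c1 that by blast
      also have "\<dots> \<le> D * M j" using assms(2) by (intro mult_left_mono Min_le) auto
      finally show ?thesis .
    qed
    have M_nonneg: "0 \<le> D * M i" if "i \<le> N + 1" for i
      using M_pos[OF that] assms(2) by simp
    \<comment> \<open>Reflection preserves both \<open>M\<close> and the modulus of
      \<open>u\<close>, so indices \<open>0\<close> and \<open>N + 1\<close> inherit the bound from
      \<open>2\<close> and \<open>N - 1\<close>.\<close>
    have bound_ghost: "h * \<bar>u j\<bar> \<le> D * M j" if "j \<le> N + 1" for j
    proof -
      consider "j = 0" | "j = N + 1" | "j \<in> {1..N}" using \<open>j \<le> N + 1\<close> by (cases j; cases "j = N + 1") auto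
      then show ?thesis using bound[of 2] bound[of "N - 1"] bound[of j] u M_ghost N
        by cases auto
    qed
    have signed: "h * u j \<le> D * M j" "- (h * u j) \<le> D * M j" if "j \<le> N + 1" for j
      using bound_ghost[OF that] h abs_le_D1[of "h * u j"] abs_le_D2[of "h * u j"]
      by (simp_all add: abs_mult)
    \<comment> \<open>Of the two values of \<open>M\<close> in a diffusion coefficient, the one at
      the neighbour dominates the velocity there, and the other is nonnegative.\<close>
    have left: "h * u (i - 1) \<le> D * (M (i - 1) + M i)" if "i \<in> {1..N}" for i
      using signed(1)[of "i - 1"] M_nonneg[of i] that by (cases i) (auto simp: distrib_left)
    have right: "- (h * u (i + 1)) \<le> D * (M i + M (i + 1))" if "i \<in> {1..N}" for i
      using signed(2)[of "i + 1"] M_nonneg[of i] that by (simp add: distrib_left)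
    \<comment> \<open>The row sum of row \<open>k\<close> is exactly the second constraint at grid
      index \<open>k + 1\<close>.\<close>
    have row: "0 < (\<Sum>j<N. ?A $$ (k, j))" if "k < N" for k
      using bspec[OF c2, of "k + 1"] that N by (simp add: coeff_matrix_row_sum)
    note off = coeff_matrix_off_diagonal[OF h assms(3) N left right]
    show ?thesis
      using M_matrix_if_row_sums_pos[OF coeff_matrix_carrier _ off row]
        monotone_mat_if_row_sums_pos[OF coeff_matrix_carrier off row] N by simp
  qed
  moreover have "\<exists>c. \<forall>i\<in>{1..N}. u i = c" if "\<forall>i\<in>{1..N}. discrete_div h u i = 0"
    using vanishes_if_discrete_div_zero[of h N u] h that u by auto
  moreover have "monotone_mat ?A" if c1: ?c1 and const: "\<exists>c. \<forall>i\<in>{1..N}. u i = c"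
  proof -
    \<comment> \<open>The boundary value \<open>u 1 = 0\<close> forces the constant to be
      zero.\<close>
    have zero: "u i = 0" if "i \<in> {1..N}" for i
      using const u(1) that N by fastforce
    have "u i = 0" if "i \<le> N + 1" for i
    proof -
      consider "i = 0" | "i = N + 1" | "i \<in> {1..N}" using \<open>i \<le> N + 1\<close> by (cases i; cases "i = N + 1") auto
      then show ?thesis using zero u N by cases auto
    qed
    \<comment> \<open>With the ghost values of \<open>u\<close> zero as well, the second constraint
      reduces to positivity of \<open>M\<close>.\<close>
    then have ?c2 using M_pos by auto
    with both c1 show ?thesis by blast
  qed
  ultimately show ?thesis by blast
qed

end
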